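(* Let $N_1,\dots,N_n$ be positive integers. The family $\mathbb{M}_{N_1^2\cdots N_n^2}(\mathbb{C})$ of $\mathbb{C}$-valued hypermatrices of depth $n$, equipped with the $2^n$ pairs of multiplication/involution $(\bullet_\gamma,\star_\gamma)$, $\gamma\subset\{1,\dots,n\}$, is a hyper-C*-algebra.
   Context: A hypermatrix of depth $n$ is a multimatrix $[x^{i_1\dots i_n}_{j_1\dots j_n}]$ with complex entries and indices $i_k,j_k=1,\dots,N_k$ for $k=1,\dots,n$; these form the finite-dimensional complex vector space $\mathbb{M}_{N_1^2\cdots N_n^2}(\mathbb{C})$ (with its usual topology). For $\gamma\subset\{1,\dots,n\}$ the product $\bullet_\gamma$ acts as matrix multiplication (contraction) at the levels $k\in\gamma$ and as the entrywise (Schur) product at the levels $k\notin\gamma$: $$(x\bullet_\gamma y)^{i_1\dots i_n}_{j_1\dots j_n}=\sum_{(o_k)_{k\in\gamma},\,1\le o_k\le N_k}x^{i_1\dots i_n}_{j'_1\dots j'_n}\;y^{i'_1\dots i'_n}_{j_1\dots j_n},$$ where $j'_k=i'_k=o_k$ for $k\in\gamma$, and $j'_k=j_k$, $i'_k=i_k$ for $k\notin\gamma$. The involution $\star_\gamma$ takes the complex conjugate of every entry and exchanges the upper index $i_k$ with the lower index $j_k$ for $k\in\gamma$, leaving the indices at levels $k\notin\gamma$ unchanged. A hyper-C*-algebra is a complete topological complex vector space equipped with a finite family of pairs of multiplication/involution, each inducing on it the structure of a (unital) C*-algebra via a (necessarily unique) C*-norm compatible with the given topology. *)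

theory Defs
  imports "HOL-Analysis.Analysis" "HOL-Algebra.Module"
begin

text \<open>
  The vector space of hypermatrices depends on the numbers \<open>n, N\<^sub>1, \<dots>, N\<^sub>n\<close>, so everything is
  relative to a carrier set.  A complex vector space is a module (in the sense of \<open>HOL-Algebra\<close>)
  over \<open>complex_ring\<close>; the fields \<open>mult\<close> and \<open>one\<close> of the record of the module play no role
  and are overwritten once a multiplication has been chosen.
\<close>

definition complex_ring :: "complex ring" where
  "complex_ring = \<lparr>carrier = UNIV, mult = (*), one = 1, zero = 0, add = (+)\<rparr>"

locale complex_topological_vector_space = Module.module complex_ring V
  for V :: "(complex, 'a) module" (structure) +
  fixes T :: "'a topology"
  assumes topspace_eq: "topspace T = carrier V"
    and continuous_add: "continuous_map (prod_topology T T) T (\<lambda>(x, y). x \<oplus> y)"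
    and continuous_smult:
      "continuous_map (prod_topology euclidean T) T (\<lambda>(c, x). c \<odot>\<^bsub>V\<^esub> x)"
begin

definition cauchy_filter_on :: "'a filter \<Rightarrow> bool" where
  "cauchy_filter_on F \<longleftrightarrow> F \<noteq> bot \<and> (\<forall>\<^sub>F x in F. x \<in> carrier V) \<and>
     (\<forall>U. openin T U \<and> \<zero> \<in> U \<longrightarrow>
        (\<exists>S \<subseteq> carrier V. (\<forall>\<^sub>F x in F. x \<in> S) \<and> (\<forall>x\<in>S. \<forall>y\<in>S. x \<ominus> y \<in> U)))"

end

locale complete_complex_topological_vector_space = complex_topological_vector_space +
  assumes complete: "cauchy_filter_on F \<Longrightarrow> \<exists>l. limitin T (\<lambda>x. x) l F"

text \<open>
  The distance is \<open>0\<close> outside the carrier because \<^locale>\<open>Metric_space\<close> requires a distance that is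
  nonnegative and symmetric on the whole type.
\<close>

definition norm_dist :: "('k, 'a, 'm) module_scheme \<Rightarrow> ('a \<Rightarrow> real) \<Rightarrow> 'a \<Rightarrow> 'a \<Rightarrow> real" where
  "norm_dist A nrm x y =
     (if x \<in> carrier A \<and> y \<in> carrier A then nrm (x \<ominus>\<^bsub>A\<^esub> y) else 0)"

locale unital_Cstar_algebra = Module.module complex_ring A + A?: ring A
  for A :: "(complex, 'a) module" (structure) +
  fixes star :: "'a \<Rightarrow> 'a" and nrm :: "'a \<Rightarrow> real"
  assumes smult_mult_left:
      "\<lbrakk>x \<in> carrier A; y \<in> carrier A\<rbrakk> \<Longrightarrow> (c \<odot>\<^bsub>A\<^esub> x) \<otimes> y = c \<odot>\<^bsub>A\<^esub> (x \<otimes> y)"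
    and smult_mult_right:
      "\<lbrakk>x \<in> carrier A; y \<in> carrier A\<rbrakk> \<Longrightarrow> x \<otimes> (c \<odot>\<^bsub>A\<^esub> y) = c \<odot>\<^bsub>A\<^esub> (x \<otimes> y)"
    and star_closed: "x \<in> carrier A \<Longrightarrow> star x \<in> carrier A"
    and star_star: "x \<in> carrier A \<Longrightarrow> star (star x) = x"
    and star_add: "\<lbrakk>x \<in> carrier A; y \<in> carrier A\<rbrakk> \<Longrightarrow> star (x \<oplus> y) = star x \<oplus> star y"
    and star_smult: "x \<in> carrier A \<Longrightarrow> star (c \<odot>\<^bsub>A\<^esub> x) = cnj c \<odot>\<^bsub>A\<^esub> star x"
    and star_mult: "\<lbrakk>x \<in> carrier A; y \<in> carrier A\<rbrakk> \<Longrightarrow> star (x \<otimes> y) = star y \<otimes> star x"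
    and nrm_nonneg: "x \<in> carrier A \<Longrightarrow> 0 \<le> nrm x"
    and nrm_eq_0: "x \<in> carrier A \<Longrightarrow> nrm x = 0 \<longleftrightarrow> x = \<zero>"
    and nrm_smult: "x \<in> carrier A \<Longrightarrow> nrm (c \<odot>\<^bsub>A\<^esub> x) = cmod c * nrm x"
    and nrm_triangle: "\<lbrakk>x \<in> carrier A; y \<in> carrier A\<rbrakk> \<Longrightarrow> nrm (x \<oplus> y) \<le> nrm x + nrm y"
    and nrm_mult: "\<lbrakk>x \<in> carrier A; y \<in> carrier A\<rbrakk> \<Longrightarrow> nrm (x \<otimes> y) \<le> nrm x * nrm y"
    and Cstar_identity: "x \<in> carrier A \<Longrightarrow> nrm (star x \<otimes> x) = (nrm x)\<^sup>2"
    and nrm_complete: "Metric_space.mcomplete (carrier A) (norm_dist A nrm)"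

definition hyper_Cstar_algebra ::
  "(complex, 'a) module \<Rightarrow> 'a topology \<Rightarrow> 'c set \<Rightarrow> ('c \<Rightarrow> 'a \<Rightarrow> 'a \<Rightarrow> 'a) \<Rightarrow> ('c \<Rightarrow> 'a \<Rightarrow> 'a) \<Rightarrow> bool"
  where
  "hyper_Cstar_algebra V T \<Gamma> mul star \<longleftrightarrow>
     complete_complex_topological_vector_space V T \<and> finite \<Gamma> \<and>
     (\<forall>\<gamma>\<in>\<Gamma>. \<exists>e nrm.
        unital_Cstar_algebra (V\<lparr>mult := mul \<gamma>, one := e\<rparr>) (star \<gamma>) nrm \<and>
        Metric_space.mtopology (carrier V) (norm_dist V nrm) = T)"

text \<open>
  A hypermatrix \<open>x\<close> of depth \<open>n\<close> is a function on pairs \<open>(i, j)\<close> of multi-indices, \<open>i = (i\<^sub>1, \<dots>, i\<^sub>n)\<close>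
  being the upper and \<open>j = (j\<^sub>1, \<dots>, j\<^sub>n)\<close> the lower one.  Multi-indices and hypermatrices are
  extensional functions, that is, \<open>undefined\<close> outside their domain.
\<close>

type_synonym multi_index = "nat \<Rightarrow> nat"
type_synonym hypermatrix = "multi_index \<times> multi_index \<Rightarrow> complex"

definition multi_indices :: "nat set \<Rightarrow> (nat \<Rightarrow> nat) \<Rightarrow> multi_index set" where
  "multi_indices K N = (\<Pi>\<^sub>E k\<in>K. {1..N k})"

definition hm_positions :: "nat \<Rightarrow> (nat \<Rightarrow> nat) \<Rightarrow> (multi_index \<times> multi_index) set" where
  "hm_positions n N = multi_indices {1..n} N \<times> multi_indices {1..n} N"

definition hypermatrix_space :: "nat \<Rightarrow> (nat \<Rightarrow> nat) \<Rightarrow> (complex, hypermatrix) module" where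
  "hypermatrix_space n N =
     \<lparr>carrier = (\<Pi>\<^sub>E p\<in>hm_positions n N. UNIV),
      mult = undefined, one = undefined,
      zero = (\<lambda>p\<in>hm_positions n N. 0),
      add = (\<lambda>x y. \<lambda>p\<in>hm_positions n N. x p + y p),
      smult = (\<lambda>c x. \<lambda>p\<in>hm_positions n N. c * x p)\<rparr>"

definition hypermatrix_topology :: "nat \<Rightarrow> (nat \<Rightarrow> nat) \<Rightarrow> hypermatrix topology" where
  "hypermatrix_topology n N = product_topology (\<lambda>_. euclidean) (hm_positions n N)"

text \<open>
  \<^term>\<open>override_on j l \<gamma>\<close> agrees with \<open>l\<close> at the levels in \<open>\<gamma>\<close> and with \<open>j\<close> at all other levels.
\<close>

definition hm_mult ::
  "nat \<Rightarrow> (nat \<Rightarrow> nat) \<Rightarrow> nat set \<Rightarrow> hypermatrix \<Rightarrow> hypermatrix \<Rightarrow> hypermatrix" where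
  "hm_mult n N \<gamma> x y =
     (\<lambda>(i, j)\<in>hm_positions n N.
        \<Sum>l\<in>multi_indices \<gamma> N. x (i, override_on j l \<gamma>) * y (override_on i l \<gamma>, j))"

definition hm_star :: "nat \<Rightarrow> (nat \<Rightarrow> nat) \<Rightarrow> nat set \<Rightarrow> hypermatrix \<Rightarrow> hypermatrix" where
  "hm_star n N \<gamma> x =
     (\<lambda>(i, j)\<in>hm_positions n N. cnj (x (override_on i j \<gamma>, override_on j i \<gamma>)))"

end

theory Submission
  imports Defs
begin

text \<open>
  The \<open>C\<^sup>*\<close>-norm of the product \<open>\<bullet>\<^sub>\<gamma>\<close> is the operator norm of the left regular representation.  Give the
  space of hypermatrices the inner product \<open>\<langle>x, y\<rangle> = \<Sum>\<^sub>i\<^sub>j cnj (x\<^sub>i\<^sub>j) y\<^sub>i\<^sub>j\<close>, and let \<open>L\<^sub>x\<close> be left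
  multiplication by \<open>x\<close> for \<open>\<bullet>\<^sub>\<gamma>\<close>.  The one fact about hypermatrices behind the theorem is that
  the adjoint of \<open>L\<^sub>x\<close> is left multiplication by \<open>\<star>\<^sub>\<gamma> x\<close> (lemma \<open>hm_mult_adjoint\<close>).  Apart from
  this, \<open>\<bullet>\<^sub>\<gamma>\<close> is associative with a unit that is a Kronecker delta at the levels in \<open>\<gamma>\<close> and
  constantly \<open>1\<close> at the others.

  The rest holds for any finite-dimensional algebra with these properties (locale
  \<open>adjointable_fun_algebra\<close>).  The map \<open>x \<mapsto> L\<^sub>x\<close> is multiplicative, and it is injective because
  \<open>x = L\<^sub>x e\<close> for the unit \<open>e\<close>.  Hence the laws of the involution are inherited from the laws
  of the adjoint, and \<open>\<parallel>x\<parallel> = \<parallel>L\<^sub>x\<parallel>\<close> is a submultiplicative norm.  The \<open>C\<^sup>*\<close>-identity is that of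
  operators: \<open>\<parallel>x y\<parallel>\<^sup>2 = \<langle>y, x\<^sup>* x y\<rangle> \<le> \<parallel>x\<^sup>* x\<parallel>\<close> for vectors \<open>y\<close> in the unit ball.

  Finally, \<open>\<parallel>x\<parallel>\<close> and the largest modulus of an entry of \<open>x\<close> bound each other up to constants: one
  bound comes from evaluating \<open>L\<^sub>x\<close> at the unit, the other from continuity of the product.  So the
  norm induces the product topology and is complete (lemma
  \<open>norm_equivalent_to_coordinates\<close>).
\<close>

section \<open>Functions on a finite set as a topological vector space\<close>

text \<open>
  Hypermatrices are the functions on a finite set of positions, and their vector space structure
  does not see the decomposition of a position into levels.  The multiplicative fields are
  \<open>undefined\<close> so that the space of hypermatrices is literally an instance.
\<close>

definition fun_space :: "'i set \<Rightarrow> (complex, 'i \<Rightarrow> complex) module" where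
  "fun_space P = \<lparr>carrier = extensional P, mult = undefined, one = undefined,
     zero = (\<lambda>p\<in>P. 0), add = (\<lambda>x y. \<lambda>p\<in>P. x p + y p), smult = (\<lambda>c x. \<lambda>p\<in>P. c * x p)\<rparr>"

lemma fun_space_simps [simp]:
  "carrier (fun_space P) = extensional P"
  "zero (fun_space P) = (\<lambda>p\<in>P. 0)"
  "add (fun_space P) = (\<lambda>x y. \<lambda>p\<in>P. x p + y p)"
  "smult (fun_space P) = (\<lambda>c x. \<lambda>p\<in>P. c * x p)"
  by (simp_all add: fun_space_def)

lemma complex_ring_simps [simp]:
  "carrier complex_ring = UNIV" "zero complex_ring = 0" "one complex_ring = 1"
  "add complex_ring = (+)" "mult complex_ring = (*)"
  by (simp_all add: complex_ring_def)

lemma cring_complex_ring: "cring complex_ring"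
proof (rule cringI)
  show "abelian_group complex_ring"
  proof (rule abelian_groupI)
    fix x assume "x \<in> carrier complex_ring"
    show "\<exists>y\<in>carrier complex_ring. y \<oplus>\<^bsub>complex_ring\<^esub> x = \<zero>\<^bsub>complex_ring\<^esub>"
      by (rule bexI[of _ "- x"]) auto
  qed auto
  show "comm_monoid complex_ring"
    by unfold_locales auto
qed (auto simp: algebra_simps)

lemma abelian_group_fun_space: "abelian_group (fun_space P\<lparr>mult := m, one := u\<rparr>)"
proof (rule abelian_groupI)
  fix x assume "x \<in> carrier (fun_space P\<lparr>mult := m, one := u\<rparr>)"
  then show "\<exists>y\<in>carrier (fun_space P\<lparr>mult := m, one := u\<rparr>).
      y \<oplus>\<^bsub>fun_space P\<lparr>mult := m, one := u\<rparr>\<^esub> x = \<zero>\<^bsub>fun_space P\<lparr>mult := m, one := u\<rparr>\<^esub>"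
    by (intro bexI[of _ "\<lambda>p\<in>P. - x p"]) (auto intro!: extensionalityI[of _ P])
qed (auto intro!: extensionalityI[of _ P] simp: add_ac)

lemma module_fun_space: "Module.module complex_ring (fun_space P\<lparr>mult := m, one := u\<rparr>)"
  by (rule moduleI[OF cring_complex_ring abelian_group_fun_space])
    (auto intro!: extensionalityI[of _ P] simp: algebra_simps)

lemma module_fun_space': "Module.module complex_ring (fun_space P)"
  using module_fun_space[where P = P and m = "mult (fun_space P)" and u = "one (fun_space P)"] by simp

lemma minus_fun_space:
  assumes "x \<in> extensional P" "y \<in> extensional P"
  shows "x \<ominus>\<^bsub>fun_space P\<lparr>mult := m, one := u\<rparr>\<^esub> y = (\<lambda>p\<in>P. x p - y p)"
proof -
  interpret abelian_group "fun_space P\<lparr>mult := m, one := u\<rparr>"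
    by (rule abelian_group_fun_space)
  have "\<ominus>\<^bsub>fun_space P\<lparr>mult := m, one := u\<rparr>\<^esub> y = (\<lambda>p\<in>P. - y p)"
    by (rule minus_equality) (use assms in \<open>auto intro!: extensionalityI[of _ P]\<close>)
  then show ?thesis
    by (auto simp: a_minus_def intro!: extensionalityI[of _ P])
qed

lemma minus_fun_space':
  assumes "x \<in> extensional P" "y \<in> extensional P"
  shows "x \<ominus>\<^bsub>fun_space P\<^esub> y = (\<lambda>p\<in>P. x p - y p)"
  using minus_fun_space[OF assms, where m = "mult (fun_space P)" and u = "one (fun_space P)"] by simp

text \<open>
  The \<open>C\<^sup>*\<close>-axioms measure distances in the record with its multiplication filled in, the topology
  is compared in the bare vector space; the two distances agree because subtraction
  ignores the multiplication.
\<close>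

lemma norm_dist_fun_space:
  "norm_dist (fun_space P\<lparr>mult := m, one := u\<rparr>) nrm = norm_dist (fun_space P) nrm"
  by (intro ext) (simp add: norm_dist_def minus_fun_space minus_fun_space')

text \<open>
  Since the index set is finite, the radii at the separate coordinates have a positive minimum, and
  the product topology is that of the maximum norm.  This form can be compared directly with
  balls of another norm.
\<close>

lemma openin_finite_product_iff:
  fixes U :: "('i \<Rightarrow> complex) set"
  assumes "finite P"
  shows "openin (product_topology (\<lambda>_. euclidean) P) U \<longleftrightarrow>
    U \<subseteq> extensional P \<and>
    (\<forall>x\<in>U. \<exists>\<epsilon>>0. \<forall>y\<in>extensional P. (\<forall>p\<in>P. cmod (x p - y p) < \<epsilon>) \<longrightarrow> y \<in> U)"
    (is "_ \<longleftrightarrow> ?R")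
proof
  assume U: "openin (product_topology (\<lambda>_. euclidean) P) U"
  show ?R
  proof (intro conjI ballI)
    show "U \<subseteq> extensional P"
      using openin_subset[OF U] by (simp add: PiE_def)
    fix x assume "x \<in> U"
    with U have "\<exists>W. finite {p \<in> P. W p \<noteq> topspace euclidean} \<and>
        (\<forall>p\<in>P. openin euclidean (W p)) \<and> x \<in> PiE P W \<and> PiE P W \<subseteq> U"
      unfolding openin_product_topology_alt by (rule bspec)
    then obtain W where W: "\<And>p. p \<in> P \<Longrightarrow> open (W p)" "x \<in> PiE P W" "PiE P W \<subseteq> U"
      by auto
    have "\<exists>r>0. \<forall>z. cmod (x p - z) < r \<longrightarrow> z \<in> W p" if "p \<in> P" for p
      using W(1)[OF that] W(2) that unfolding open_dist PiE_iff
      by (metis dist_commute dist_norm)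
    then obtain r where r: "\<And>p. p \<in> P \<Longrightarrow> r p > (0::real)"
      "\<And>p z. p \<in> P \<Longrightarrow> cmod (x p - z) < r p \<Longrightarrow> z \<in> W p"
      by metis
    \<comment> \<open>The \<open>1\<close> keeps the minimum meaningful when the index set is empty.\<close>
    define \<epsilon> where "\<epsilon> = Min (insert 1 (r ` P))"
    have "\<epsilon> > 0" "\<And>p. p \<in> P \<Longrightarrow> \<epsilon> \<le> r p"
      using assms r(1) by (auto simp: \<epsilon>_def)
    moreover have "y \<in> U" if y: "y \<in> extensional P" "\<forall>p\<in>P. cmod (x p - y p) < \<epsilon>" for y
    proof -
      have "y p \<in> W p" if "p \<in> P" for p
        using r(2)[OF that] calculation(2)[OF that] y(2) that by (meson less_le_trans)
      with y(1) have "y \<in> PiE P W"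
        by (simp add: PiE_iff)
      then show ?thesis using W(3) by blast
    qed
    ultimately show "\<exists>\<epsilon>>0. \<forall>y\<in>extensional P. (\<forall>p\<in>P. cmod (x p - y p) < \<epsilon>) \<longrightarrow> y \<in> U"
      by blast
  qed
next
  assume R: ?R
  show "openin (product_topology (\<lambda>_. euclidean) P) U"
    unfolding openin_product_topology_alt
  proof
    fix x assume x: "x \<in> U"
    then obtain \<epsilon> where \<epsilon>: "\<epsilon> > 0"
      "\<And>y. y \<in> extensional P \<Longrightarrow> \<forall>p\<in>P. cmod (x p - y p) < \<epsilon> \<Longrightarrow> y \<in> U"
      using R by metis
    have "x \<in> (\<Pi>\<^sub>E p\<in>P. ball (x p) \<epsilon>)"
      using x R \<epsilon>(1) by (auto simp: PiE_iff)
    moreover have "(\<Pi>\<^sub>E p\<in>P. ball (x p) \<epsilon>) \<subseteq> U"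
      using \<epsilon>(2) by (auto simp: PiE_iff dist_norm)
    ultimately show "\<exists>W. finite {p \<in> P. W p \<noteq> topspace euclidean} \<and>
        (\<forall>p\<in>P. openin euclidean (W p)) \<and> x \<in> PiE P W \<and> PiE P W \<subseteq> U"
      using assms by (intro exI[of _ "\<lambda>p. ball (x p) \<epsilon>"]) auto
  qed
qed

text \<open>
  Completeness is inherited from \<open>\<complex>\<close> coordinate by coordinate: the set of functions whose value at
  \<open>p\<close> is small is a neighbourhood of zero, so evaluation at \<open>p\<close> sends a Cauchy filter
  to a Cauchy filter of complex numbers.
\<close>

lemma complete_tvs_fun_space:
  fixes P :: "'i set"
  assumes fin: "finite P"
  shows "complete_complex_topological_vector_space (fun_space P) (product_topology (\<lambda>_. euclidean) P)"
    (is "complete_complex_topological_vector_space ?V ?T")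
proof -
  interpret Module.module complex_ring ?V
    by (rule module_fun_space')
  interpret complex_topological_vector_space ?V ?T
  proof
    show "topspace ?T = carrier ?V"
      by (simp add: PiE_def)
    have fst_p: "continuous_map (prod_topology ?T ?T) euclidean (\<lambda>z. fst z p)"
      and snd_p: "continuous_map (prod_topology X ?T) euclidean (\<lambda>z. snd z p)"
      if "p \<in> P" for p and X :: "'b topology"
      using continuous_map_compose[OF continuous_map_fst continuous_map_product_projection[OF that]]
        continuous_map_compose[OF continuous_map_snd continuous_map_product_projection[OF that]]
      by (fastforce simp: o_def)+
    show "continuous_map (prod_topology ?T ?T) ?T (\<lambda>(x, y). x \<oplus>\<^bsub>?V\<^esub> y)"
      by (auto simp: continuous_map_componentwise case_prod_unfold
          intro!: continuous_map_add fst_p snd_p)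
    have "continuous_map (prod_topology euclidean ?T) euclidean
        (\<lambda>z. fst z * snd z p :: complex)" if "p \<in> P" for p
    proof -
      have pair: "continuous_map (prod_topology euclidean ?T) (prod_topology euclidean euclidean)
          (\<lambda>z. (fst z :: complex, snd z p :: complex))"
        unfolding continuous_map_pairwise
        using snd_p[OF that] by (simp add: o_def continuous_map_fst)
      have times: "continuous_map (prod_topology euclidean euclidean) euclidean
          (\<lambda>z. fst z * snd z :: complex)"
        by (auto simp: euclidean_product_topology intro!: continuous_intros)
      show ?thesis
        using continuous_map_compose[OF pair times] by (simp add: o_def)
    qed
    then show "continuous_map (prod_topology euclidean ?T) ?T (\<lambda>(c, x). c \<odot>\<^bsub>?V\<^esub> x)"
      by (auto simp: continuous_map_componentwise case_prod_unfold)
  qed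
  show ?thesis
  proof
    fix F assume F: "cauchy_filter_on F"
    then have nb: "F \<noteq> bot" and ev: "\<forall>\<^sub>F x in F. x \<in> extensional P"
      by (auto simp: cauchy_filter_on_def)
    have "\<exists>l. ((\<lambda>x. x p) \<longlongrightarrow> l) F" if p: "p \<in> P" for p
    proof -
      have "cauchy_filter (filtermap (\<lambda>x. x p) F)"
        unfolding cauchy_filter_metric_filtermap
      proof (intro allI impI)
        fix \<epsilon> :: real assume "\<epsilon> > 0"
        let ?U = "{x \<in> extensional P. x p \<in> ball 0 \<epsilon>}"
        have "openin ?T ?U"
          using openin_continuous_map_preimage[OF continuous_map_product_projection[OF p],
              of "\<lambda>_. euclidean" "ball 0 \<epsilon> :: complex set"]
          by (simp add: PiE_def)
        moreover have "\<zero>\<^bsub>?V\<^esub> \<in> ?U"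
          using \<open>\<epsilon> > 0\<close> p by simp
        ultimately obtain S where S: "S \<subseteq> extensional P" "\<forall>\<^sub>F x in F. x \<in> S"
          "\<And>x y. x \<in> S \<Longrightarrow> y \<in> S \<Longrightarrow> x \<ominus>\<^bsub>?V\<^esub> y \<in> ?U"
          using F unfolding cauchy_filter_on_def by force
        have "dist (x p) (y p) < \<epsilon>" if "x \<in> S" "y \<in> S" for x y
          using S(1) S(3)[OF that] that p minus_fun_space'[of x P y]
          by (auto simp: dist_norm subset_iff)
        then show "\<exists>Q. eventually Q F \<and> (\<forall>x y. Q x \<and> Q y \<longrightarrow> dist (x p) (y p) < \<epsilon>)"
          using S(2) by (intro exI[of _ "\<lambda>x. x \<in> S"]) auto
      qed
      moreover have "complete (UNIV :: complex set)"
        by (rule complete_UNIV)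
      ultimately show ?thesis
        using nb unfolding complete_uniform filterlim_def
        by (auto simp: filtermap_bot_iff)
    qed
    then obtain l where l: "\<And>p. p \<in> P \<Longrightarrow> ((\<lambda>x. x p) \<longlongrightarrow> l p) F"
      by metis
    have "limitin ?T (\<lambda>x. x) (restrict l P) F"
      using ev l by (simp add: limitin_componentwise PiE_def)
    then show "\<exists>l. limitin ?T (\<lambda>x. x) l F"
      by blast
  qed
qed

text \<open>
  A norm that controls each coordinate, and is controlled by a bound on all of them, has the same
  convergent and the same Cauchy sequences as coordinatewise convergence.  The two estimates
  are asked for separately because they have unrelated proofs for an operator norm.
\<close>

lemma norm_equivalent_to_coordinates:
  fixes P :: "'i set" and nrm :: "('i \<Rightarrow> complex) \<Rightarrow> real"
  assumes fin: "finite P"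
    and nonneg: "\<And>x. x \<in> extensional P \<Longrightarrow> 0 \<le> nrm x"
    and eq_0: "\<And>x. x \<in> extensional P \<Longrightarrow> nrm x = 0 \<longleftrightarrow> x = (\<lambda>p\<in>P. 0)"
    and minus: "\<And>x. x \<in> extensional P \<Longrightarrow> nrm (\<lambda>p\<in>P. - x p) = nrm x"
    and triangle: "\<And>x y. \<lbrakk>x \<in> extensional P; y \<in> extensional P\<rbrakk>
      \<Longrightarrow> nrm (\<lambda>p\<in>P. x p + y p) \<le> nrm x + nrm y"
    and coord: "\<And>x p. \<lbrakk>x \<in> extensional P; p \<in> P\<rbrakk> \<Longrightarrow> cmod (x p) \<le> a * nrm x"
    and small: "\<And>x \<delta>. \<lbrakk>x \<in> extensional P; 0 \<le> \<delta>; \<And>p. p \<in> P \<Longrightarrow> cmod (x p) \<le> \<delta>\<rbrakk>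
      \<Longrightarrow> nrm x \<le> b * \<delta>"
  shows "Metric_space.mtopology (extensional P) (norm_dist (fun_space P) nrm)
      = product_topology (\<lambda>_. euclidean) P"
    and "Metric_space.mcomplete (extensional P) (norm_dist (fun_space P) nrm)"
proof -
  let ?d = "norm_dist (fun_space P) nrm" and ?T = "product_topology (\<lambda>_. euclidean) P"
  have d: "?d x y = nrm (\<lambda>p\<in>P. x p - y p)" if "x \<in> extensional P" "y \<in> extensional P" for x y
    using that by (simp add: norm_dist_def minus_fun_space')
  interpret Metric_space "extensional P" ?d
  proof
    fix x y :: "'i \<Rightarrow> complex"
    show "0 \<le> ?d x y"
      by (auto simp: norm_dist_def minus_fun_space' nonneg)
    show "?d x y = ?d y x"
    proof (cases "x \<in> extensional P \<and> y \<in> extensional P")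
      case True
      have "(\<lambda>p\<in>P. y p - x p) = (\<lambda>p\<in>P. - (\<lambda>p\<in>P. x p - y p) p)"
        by (auto intro!: extensionalityI[of _ P])
      with True show ?thesis
        by (metis d minus restrict_extensional)
    qed (auto simp: norm_dist_def)
  next
    fix x y :: "'i \<Rightarrow> complex" assume xy: "x \<in> extensional P" "y \<in> extensional P"
    then show "?d x y = 0 \<longleftrightarrow> x = y"
      by (auto simp: d eq_0 fun_eq_iff extensional_def, metis)
  next
    fix x y z :: "'i \<Rightarrow> complex" assume *: "x \<in> extensional P" "y \<in> extensional P" "z \<in> extensional P"
    have "(\<lambda>p\<in>P. x p - z p) = (\<lambda>p\<in>P. (\<lambda>p\<in>P. x p - y p) p + (\<lambda>p\<in>P. y p - z p) p)"
      by (auto intro!: extensionalityI[of _ P])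
    with triangle[of "\<lambda>p\<in>P. x p - y p" "\<lambda>p\<in>P. y p - z p"] * show "?d x z \<le> ?d x y + ?d y z"
      by (simp only: d restrict_extensional simp_thms)
  qed
  \<comment> \<open>Radii are divided by the constants, so these are enlarged to be positive.\<close>
  define A where "A = max a 0 + 1"
  define B where "B = max b 0 + 1"
  have AB: "A > 0" "B > 0" "a \<le> A" "b \<le> B"
    by (auto simp: A_def B_def)
  have coord': "cmod (x p - y p) \<le> A * ?d x y"
    if "x \<in> extensional P" "y \<in> extensional P" "p \<in> P" for x y p
  proof -
    have "cmod (x p - y p) \<le> a * ?d x y"
      using coord[of "\<lambda>p\<in>P. x p - y p" p] that by (simp add: d)
    also have "\<dots> \<le> A * ?d x y"
      using AB by (intro mult_right_mono) auto
    finally show ?thesis .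
  qed
  \<comment> \<open>The factor 2 turns the weak bound \<open>small\<close> into the strict one that an open ball needs.\<close>
  have small': "?d x y < r"
    if "x \<in> extensional P" "y \<in> extensional P" "0 < r" "\<forall>p\<in>P. cmod (x p - y p) < r / (2 * B)"
    for x y r
  proof -
    have "?d x y \<le> b * (r / (2 * B))"
      using small[of "\<lambda>p\<in>P. x p - y p" "r / (2 * B)"] that AB by (force simp: d less_imp_le)
    also have "\<dots> \<le> B * (r / (2 * B))"
      using AB that by (intro mult_right_mono) auto
    also have "\<dots> < r"
      using AB that by simp
    finally show ?thesis .
  qed
  show top: "mtopology = ?T"
  proof (rule topology_eq[THEN iffD2], intro allI)
    fix U
    have iff: "(\<exists>r>0. mball x r \<subseteq> U) \<longleftrightarrow>
        (\<exists>\<epsilon>>0. \<forall>y\<in>extensional P. (\<forall>p\<in>P. cmod (x p - y p) < \<epsilon>) \<longrightarrow> y \<in> U)"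
      if x: "x \<in> extensional P" for x
    proof
      assume "\<exists>r>0. mball x r \<subseteq> U"
      then obtain r where "r > 0" "mball x r \<subseteq> U" by blast
      then show "\<exists>\<epsilon>>0. \<forall>y\<in>extensional P. (\<forall>p\<in>P. cmod (x p - y p) < \<epsilon>) \<longrightarrow> y \<in> U"
        using small'[OF x _ \<open>r > 0\<close>] x AB
        by (intro exI[of _ "r / (2 * B)"]) (auto simp: subset_iff)
    next
      assume "\<exists>\<epsilon>>0. \<forall>y\<in>extensional P. (\<forall>p\<in>P. cmod (x p - y p) < \<epsilon>) \<longrightarrow> y \<in> U"
      then obtain \<epsilon> where e: "\<epsilon> > 0"
        "\<And>y. y \<in> extensional P \<Longrightarrow> \<forall>p\<in>P. cmod (x p - y p) < \<epsilon> \<Longrightarrow> y \<in> U" by blast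
      have "y \<in> U" if y: "y \<in> extensional P" "?d x y < \<epsilon> / A" for y
      proof (rule e(2)[OF y(1)], intro ballI)
        fix p assume "p \<in> P"
        with coord'[OF x y(1)] have "cmod (x p - y p) \<le> A * ?d x y" by blast
        also have "\<dots> < \<epsilon>"
          using y(2) AB by (simp add: field_simps)
        finally show "cmod (x p - y p) < \<epsilon>" .
      qed
      then show "\<exists>r>0. mball x r \<subseteq> U"
        using e(1) AB by (intro exI[of _ "\<epsilon> / A"]) auto
    qed
    show "openin mtopology U \<longleftrightarrow> openin ?T U"
      unfolding openin_mtopology openin_finite_product_iff[OF fin] Ball_def[of U]
      by (intro conj_cong refl iff_allI imp_cong iff) auto
  qed
  show mcomplete
    unfolding mcomplete_def
  proof (intro allI impI)
    fix \<sigma> assume "MCauchy \<sigma>"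
    then have \<sigma>: "\<And>m. \<sigma> m \<in> extensional P"
      and C: "\<And>\<epsilon>. \<epsilon> > 0 \<Longrightarrow> \<exists>M. \<forall>m m'. M \<le> m \<longrightarrow> M \<le> m' \<longrightarrow> ?d (\<sigma> m) (\<sigma> m') < \<epsilon>"
      by (auto simp: MCauchy_def)
    have "\<exists>l. (\<lambda>m. \<sigma> m p) \<longlonglongrightarrow> l" if p: "p \<in> P" for p
    proof -
      have "Cauchy (\<lambda>m. \<sigma> m p)"
      proof (rule metric_CauchyI)
        fix \<epsilon> :: real assume "\<epsilon> > 0"
        then obtain M where M: "\<And>m m'. M \<le> m \<Longrightarrow> M \<le> m' \<Longrightarrow> ?d (\<sigma> m) (\<sigma> m') < \<epsilon> / A"
          using C[of "\<epsilon> / A"] AB by auto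
        have "dist (\<sigma> m p) (\<sigma> m' p) < \<epsilon>" if "M \<le> m" "M \<le> m'" for m m'
        proof -
          have "dist (\<sigma> m p) (\<sigma> m' p) \<le> A * ?d (\<sigma> m) (\<sigma> m')"
            using coord'[OF \<sigma> \<sigma> p] by (simp add: dist_norm)
          also have "\<dots> < \<epsilon>"
            using M[OF that] AB by (simp add: field_simps)
          finally show ?thesis .
        qed
        then show "\<exists>M. \<forall>m\<ge>M. \<forall>m'\<ge>M. dist (\<sigma> m p) (\<sigma> m' p) < \<epsilon>" by blast
      qed
      then show ?thesis
        by (simp add: Cauchy_convergent_iff convergent_def)
    qed
    then obtain l where "\<And>p. p \<in> P \<Longrightarrow> (\<lambda>m. \<sigma> m p) \<longlonglongrightarrow> l p"
      by metis
    then have "limitin ?T \<sigma> (restrict l P) sequentially"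
      using \<sigma> by (simp add: limitin_componentwise PiE_def)
    then show "\<exists>x. limitin mtopology \<sigma> x sequentially"
      unfolding top by blast
  qed
qed

section \<open>The operator norm of left multiplication\<close>

definition inner_on :: "'i set \<Rightarrow> ('i \<Rightarrow> complex) \<Rightarrow> ('i \<Rightarrow> complex) \<Rightarrow> complex" where
  "inner_on P x y = (\<Sum>p\<in>P. cnj (x p) * y p)"

definition l2_norm :: "'i set \<Rightarrow> ('i \<Rightarrow> complex) \<Rightarrow> real" where
  "l2_norm P x = L2_set (\<lambda>p. cmod (x p)) P"

lemma l2_norm_nonneg [simp]: "0 \<le> l2_norm P x"
  by (simp add: l2_norm_def)

lemma inner_on_self: "inner_on P x x = complex_of_real ((l2_norm P x)\<^sup>2)"
proof -
  have "cnj (x p) * x p = complex_of_real ((cmod (x p))\<^sup>2)" for p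
    by (metis complex_norm_square mult.commute)
  then have "inner_on P x x = (\<Sum>p\<in>P. complex_of_real ((cmod (x p))\<^sup>2))"
    unfolding inner_on_def by (rule sum.cong[OF refl])
  also have "\<dots> = complex_of_real ((l2_norm P x)\<^sup>2)"
    by (simp add: l2_norm_def L2_set_def sum_nonneg)
  finally show ?thesis .
qed

lemma cmod_inner_on_le: "cmod (inner_on P x y) \<le> l2_norm P x * l2_norm P y"
proof -
  have "cmod (inner_on P x y) \<le> (\<Sum>p\<in>P. \<bar>cmod (x p)\<bar> * \<bar>cmod (y p)\<bar>)"
    unfolding inner_on_def by (rule order_trans[OF norm_sum]) (simp add: norm_mult)
  also have "\<dots> \<le> l2_norm P x * l2_norm P y"
    unfolding l2_norm_def by (rule L2_set_mult_ineq)
  finally show ?thesis .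
qed

lemma inner_on_cnj: "inner_on P y x = cnj (inner_on P x y)"
  by (simp add: inner_on_def mult.commute)

lemma inner_on_add_right:
  "inner_on P y (\<lambda>p\<in>P. u p + v p) = inner_on P y u + inner_on P y v"
  by (simp add: inner_on_def algebra_simps sum.distrib)

lemma inner_on_add_left:
  "inner_on P (\<lambda>p\<in>P. u p + v p) y = inner_on P u y + inner_on P v y"
  by (simp add: inner_on_def algebra_simps sum.distrib)

lemma inner_on_scale_right: "inner_on P y (\<lambda>p\<in>P. c * u p) = c * inner_on P y u"
  by (simp add: inner_on_def sum_distrib_left mult_ac)

lemma inner_on_scale_left: "inner_on P (\<lambda>p\<in>P. c * u p) y = cnj c * inner_on P u y"
  by (simp add: inner_on_def sum_distrib_left mult_ac)

text \<open>
  Testing against the indicator functions of single points recovers the values, so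
  the inner product separates points.
\<close>

lemma inner_on_left_eqI:
  assumes "finite P" "u \<in> extensional P" "v \<in> extensional P"
    and "\<And>y. y \<in> extensional P \<Longrightarrow> inner_on P y u = inner_on P y v"
  shows "u = v"
proof (rule extensionalityI[OF assms(2,3)])
  fix p assume p: "p \<in> P"
  have "inner_on P (\<lambda>q\<in>P. if q = p then 1 else 0) w = w p" for w
    using p assms(1) by (simp add: inner_on_def if_distrib[of cnj] if_distrib[of "\<lambda>c. c * _"] cong: if_cong)
  then show "u p = v p"
    using assms(4)[of "\<lambda>q\<in>P. if q = p then 1 else 0"] by simp
qed

lemma l2_norm_triangle: "l2_norm P (\<lambda>p\<in>P. x p + y p) \<le> l2_norm P x + l2_norm P y"
proof -
  have "l2_norm P (\<lambda>p\<in>P. x p + y p) \<le> L2_set (\<lambda>p. cmod (x p) + cmod (y p)) P"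
    unfolding l2_norm_def by (rule L2_set_mono) (auto simp: norm_triangle_ineq)
  also have "\<dots> \<le> l2_norm P x + l2_norm P y"
    unfolding l2_norm_def by (rule L2_set_triangle_ineq)
  finally show ?thesis .
qed

lemma l2_norm_scale: "l2_norm P (\<lambda>p\<in>P. c * x p) = cmod c * l2_norm P x"
  by (simp add: l2_norm_def L2_set_right_distrib norm_mult cong: L2_set_cong)

lemma l2_norm_eq_0:
  assumes "finite P" "x \<in> extensional P"
  shows "l2_norm P x = 0 \<longleftrightarrow> x = (\<lambda>p\<in>P. 0)"
  using assms by (auto simp: l2_norm_def L2_set_eq_0_iff fun_eq_iff extensional_def)

lemma cmod_le_l2_norm: "finite P \<Longrightarrow> p \<in> P \<Longrightarrow> cmod (x p) \<le> l2_norm P x"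
  unfolding l2_norm_def by (rule member_le_L2_set)

lemma l2_norm_le_card:
  assumes "\<And>p. p \<in> P \<Longrightarrow> cmod (x p) \<le> \<delta>"
  shows "l2_norm P x \<le> real (card P) * \<delta>"
proof -
  have "l2_norm P x \<le> (\<Sum>p\<in>P. cmod (x p))"
    unfolding l2_norm_def by (rule L2_set_le_sum) simp
  also have "\<dots> \<le> real (card P) * \<delta>"
    using sum_bounded_above[of P "\<lambda>p. cmod (x p)" \<delta>] assms by simp
  finally show ?thesis .
qed

text \<open>
  A unital algebra of functions whose left multiplications have adjoints of the same kind.  The laws
  of the involution are absent from the axioms because they follow from \<open>adjoint\<close>; the bound
  \<open>mul_bounded\<close> makes the operator norm finite and continuous.
\<close>

locale adjointable_fun_algebra =
  fixes P :: "'i set"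
    and mul :: "('i \<Rightarrow> complex) \<Rightarrow> ('i \<Rightarrow> complex) \<Rightarrow> ('i \<Rightarrow> complex)"
    and star :: "('i \<Rightarrow> complex) \<Rightarrow> ('i \<Rightarrow> complex)"
    and e :: "'i \<Rightarrow> complex"
  assumes finite: "finite P"
    and mul_closed: "mul x y \<in> extensional P"
    and star_closed: "star x \<in> extensional P"
    and unit_closed: "e \<in> extensional P"
    and mul_assoc: "\<lbrakk>x \<in> extensional P; y \<in> extensional P; z \<in> extensional P\<rbrakk>
      \<Longrightarrow> mul (mul x y) z = mul x (mul y z)"
    and unit_left: "x \<in> extensional P \<Longrightarrow> mul e x = x"
    and unit_right: "x \<in> extensional P \<Longrightarrow> mul x e = x"
    and mul_add_left: "\<lbrakk>x \<in> extensional P; y \<in> extensional P; z \<in> extensional P\<rbrakk>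
      \<Longrightarrow> mul (\<lambda>p\<in>P. x p + y p) z = (\<lambda>p\<in>P. mul x z p + mul y z p)"
    and mul_add_right: "\<lbrakk>x \<in> extensional P; y \<in> extensional P; z \<in> extensional P\<rbrakk>
      \<Longrightarrow> mul z (\<lambda>p\<in>P. x p + y p) = (\<lambda>p\<in>P. mul z x p + mul z y p)"
    and mul_scale_left: "\<lbrakk>x \<in> extensional P; y \<in> extensional P\<rbrakk>
      \<Longrightarrow> mul (\<lambda>p\<in>P. c * x p) y = (\<lambda>p\<in>P. c * mul x y p)"
    and mul_scale_right: "\<lbrakk>x \<in> extensional P; y \<in> extensional P\<rbrakk>
      \<Longrightarrow> mul x (\<lambda>p\<in>P. c * y p) = (\<lambda>p\<in>P. c * mul x y p)"
    and mul_bounded: "\<exists>K\<ge>0. \<forall>x\<in>extensional P. \<forall>y\<in>extensional P.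
      l2_norm P (mul x y) \<le> K * l2_norm P x * l2_norm P y"
    and adjoint: "\<lbrakk>x \<in> extensional P; y \<in> extensional P; z \<in> extensional P\<rbrakk>
      \<Longrightarrow> inner_on P (mul x y) z = inner_on P y (mul (star x) z)"
begin

lemmas closed = mul_closed star_closed unit_closed restrict_extensional

text \<open>
  An adjoint is unique, and because of the unit an element is determined by its left multiplication.
  Each law of the involution therefore reduces to a law of adjoints.
\<close>

lemma star_eqI:
  assumes "x \<in> extensional P" "w \<in> extensional P"
    and "\<And>y z. \<lbrakk>y \<in> extensional P; z \<in> extensional P\<rbrakk>
      \<Longrightarrow> inner_on P (mul x y) z = inner_on P y (mul w z)"
  shows "star x = w"
proof -
  have "mul (star x) e = mul w e"
    by (rule inner_on_left_eqI[OF finite]) (use assms adjoint[of x] closed in auto)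
  then show ?thesis
    by (simp add: unit_right assms closed)
qed

lemma star_star: "x \<in> extensional P \<Longrightarrow> star (star x) = x"
  by (rule star_eqI) (auto simp: closed inner_on_cnj[of P "mul (star x) _"] adjoint[symmetric]
      inner_on_cnj[of P "mul x _"])

lemma star_mul:
  assumes "x \<in> extensional P" "y \<in> extensional P"
  shows "star (mul x y) = mul (star y) (star x)"
  by (rule star_eqI) (use assms in \<open>auto simp: closed mul_assoc adjoint\<close>)

lemma star_add:
  assumes "x \<in> extensional P" "y \<in> extensional P"
  shows "star (\<lambda>p\<in>P. x p + y p) = (\<lambda>p\<in>P. star x p + star y p)"
  by (rule star_eqI) (use assms in \<open>auto simp: closed mul_add_left adjoint
      inner_on_add_left inner_on_add_right\<close>)

lemma star_scale:
  assumes "x \<in> extensional P"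
  shows "star (\<lambda>p\<in>P. c * x p) = (\<lambda>p\<in>P. cnj c * star x p)"
  by (rule star_eqI) (use assms in \<open>auto simp: closed mul_scale_left adjoint
      inner_on_scale_left inner_on_scale_right\<close>)

text \<open>
  The operator norm on \<open>\<ell>\<^sup>2\<close> of left multiplication.  The supremum ranges over the unit ball and not
  the unit sphere because the ball is nonempty even if \<open>P\<close> is empty.
\<close>

definition op_norm :: "('i \<Rightarrow> complex) \<Rightarrow> real" where
  "op_norm x = (SUP y\<in>{y \<in> extensional P. l2_norm P y \<le> 1}. l2_norm P (mul x y))"

lemma bdd_above_op_norm:
  assumes "x \<in> extensional P"
  shows "bdd_above ((\<lambda>y. l2_norm P (mul x y)) ` {y \<in> extensional P. l2_norm P y \<le> 1})"
proof -
  obtain K where K: "K \<ge> 0" "\<And>y. y \<in> extensional P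
      \<Longrightarrow> l2_norm P (mul x y) \<le> K * l2_norm P x * l2_norm P y"
    using mul_bounded assms by blast
  have "l2_norm P (mul x y) \<le> K * l2_norm P x" if "y \<in> extensional P" "l2_norm P y \<le> 1" for y
    using order_trans[OF K(2)[OF that(1)] mult_left_mono[OF that(2), of "K * l2_norm P x"]] K(1)
    by simp
  then show ?thesis by (intro bdd_aboveI2) auto
qed

lemma zero_in_unit_ball: "(\<lambda>p\<in>P. 0) \<in> {y \<in> extensional P. l2_norm P y \<le> 1}"
  using l2_norm_eq_0[OF finite restrict_extensional, of "\<lambda>_. 0"] by simp

lemma op_norm_le:
  assumes "\<And>y. \<lbrakk>y \<in> extensional P; l2_norm P y \<le> 1\<rbrakk> \<Longrightarrow> l2_norm P (mul x y) \<le> c"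
  shows "op_norm x \<le> c"
  unfolding op_norm_def by (rule cSUP_least) (use zero_in_unit_ball assms in auto)

lemma l2_norm_mul_le:
  assumes x: "x \<in> extensional P" and y: "y \<in> extensional P"
  shows "l2_norm P (mul x y) \<le> op_norm x * l2_norm P y"
proof (cases "l2_norm P y = 0")
  case True
  obtain K where "l2_norm P (mul x y) \<le> K * l2_norm P x * l2_norm P y"
    using mul_bounded x y by blast
  with True show ?thesis by simp
next
  case False
  define r where "r = l2_norm P y"
  have r: "r > 0"
    unfolding r_def using False l2_norm_nonneg[of P y] by linarith
  define c where "c = complex_of_real (1 / r)"
  have c: "cmod c = 1 / r"
    using r by (simp add: c_def norm_divide)
  have "l2_norm P (mul x (\<lambda>p\<in>P. c * y p)) \<le> op_norm x"
    unfolding op_norm_def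
    by (rule cSUP_upper[OF _ bdd_above_op_norm[OF x]])
      (use r in \<open>simp add: l2_norm_scale c flip: r_def\<close>)
  then have "l2_norm P (mul x y) / r \<le> op_norm x"
    by (simp add: mul_scale_right l2_norm_scale x y c)
  with r show ?thesis
    by (simp add: field_simps flip: r_def)
qed

lemma op_norm_nonneg:
  assumes "x \<in> extensional P"
  shows "0 \<le> op_norm x"
proof -
  have "l2_norm P (mul x (\<lambda>p\<in>P. 0)) \<le> op_norm x"
    unfolding op_norm_def by (rule cSUP_upper[OF zero_in_unit_ball bdd_above_op_norm[OF assms]])
  then show ?thesis
    using l2_norm_nonneg order_trans by blast
qed

text \<open>
  Evaluating the operator at the unit recovers the element, so the representation is faithful
  and the operator norm controls the \<open>\<ell>\<^sup>2\<close>-norm of the element up to a constant.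
\<close>

lemma l2_norm_le_op_norm:
  assumes "x \<in> extensional P"
  shows "l2_norm P x \<le> l2_norm P e * op_norm x"
  using l2_norm_mul_le[OF assms unit_closed] by (simp add: unit_right assms mult.commute)

lemma op_norm_le_l2_norm:
  obtains K where "K \<ge> 0" "\<And>x. x \<in> extensional P \<Longrightarrow> op_norm x \<le> K * l2_norm P x"
proof -
  obtain K where K: "K \<ge> 0" "\<And>x y. \<lbrakk>x \<in> extensional P; y \<in> extensional P\<rbrakk>
      \<Longrightarrow> l2_norm P (mul x y) \<le> K * l2_norm P x * l2_norm P y"
    using mul_bounded by blast
  have "op_norm x \<le> K * l2_norm P x" if "x \<in> extensional P" for x
  proof (rule op_norm_le)
    fix y assume "y \<in> extensional P" "l2_norm P y \<le> 1"
    then show "l2_norm P (mul x y) \<le> K * l2_norm P x"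
      using order_trans[OF K(2) mult_left_mono[of _ 1]] K(1) that by fastforce
  qed
  with K(1) show thesis by (rule that)
qed

lemma op_norm_eq_0:
  assumes "x \<in> extensional P"
  shows "op_norm x = 0 \<longleftrightarrow> x = (\<lambda>p\<in>P. 0)"
proof -
  obtain K where "K \<ge> 0" "op_norm x \<le> K * l2_norm P x"
    using op_norm_le_l2_norm assms by metis
  then have "op_norm x = 0 \<longleftrightarrow> l2_norm P x = 0"
    using l2_norm_le_op_norm[OF assms] op_norm_nonneg[OF assms] l2_norm_nonneg[of P x]
    by (metis mult_zero_right order_antisym)
  then show ?thesis
    by (simp add: l2_norm_eq_0[OF finite assms])
qed

lemma op_norm_triangle:
  assumes x: "x \<in> extensional P" and y: "y \<in> extensional P"
  shows "op_norm (\<lambda>p\<in>P. x p + y p) \<le> op_norm x + op_norm y"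
proof (rule op_norm_le)
  fix z assume z: "z \<in> extensional P" "l2_norm P z \<le> 1"
  have "l2_norm P (mul (\<lambda>p\<in>P. x p + y p) z) \<le> l2_norm P (mul x z) + l2_norm P (mul y z)"
    by (simp add: mul_add_left x y z l2_norm_triangle)
  also have "\<dots> \<le> op_norm x * l2_norm P z + op_norm y * l2_norm P z"
    by (intro add_mono l2_norm_mul_le x y z)
  also have "\<dots> \<le> op_norm x + op_norm y"
    using z op_norm_nonneg x y by (intro add_mono mult_left_le) auto
  finally show "l2_norm P (mul (\<lambda>p\<in>P. x p + y p) z) \<le> op_norm x + op_norm y" .
qed

lemma op_norm_scale:
  assumes x: "x \<in> extensional P"
  shows "op_norm (\<lambda>p\<in>P. c * x p) = cmod c * op_norm x"
proof -
  have le: "op_norm (\<lambda>p\<in>P. c * x p) \<le> cmod c * op_norm x" if x: "x \<in> extensional P" for c x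
  proof (rule op_norm_le)
    fix z assume z: "z \<in> extensional P" "l2_norm P z \<le> 1"
    have "l2_norm P (mul x z) \<le> op_norm x"
      using l2_norm_mul_le[OF x z(1)] mult_left_le[OF z(2) op_norm_nonneg[OF x]] by simp
    then show "l2_norm P (mul (\<lambda>p\<in>P. c * x p) z) \<le> cmod c * op_norm x"
      by (simp add: mul_scale_left x z l2_norm_scale mult_left_mono)
  qed
  show ?thesis
  proof (cases "c = 0")
    case True
    then show ?thesis
      using op_norm_eq_0[OF restrict_extensional, of "\<lambda>_. 0"] by simp
  next
    case False
    then have "x = (\<lambda>p\<in>P. (1 / c) * (\<lambda>p\<in>P. c * x p) p)"
      using x by (auto intro!: extensionalityI[of _ P])
    then have "op_norm x \<le> cmod (1 / c) * op_norm (\<lambda>p\<in>P. c * x p)"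
      using le[OF restrict_extensional, of "1 / c" "\<lambda>p. c * x p"] by metis
    then show ?thesis
      using le[OF x, of c] False by (intro antisym) (auto simp: norm_divide field_simps)
  qed
qed

lemma op_norm_mul:
  assumes x: "x \<in> extensional P" and y: "y \<in> extensional P"
  shows "op_norm (mul x y) \<le> op_norm x * op_norm y"
proof (rule op_norm_le)
  fix z assume z: "z \<in> extensional P" "l2_norm P z \<le> 1"
  have "l2_norm P (mul (mul x y) z) \<le> op_norm x * l2_norm P (mul y z)"
    by (simp add: mul_assoc x y z l2_norm_mul_le closed)
  also have "\<dots> \<le> op_norm x * (op_norm y * l2_norm P z)"
    by (intro mult_left_mono l2_norm_mul_le op_norm_nonneg x y z)
  also have "\<dots> \<le> op_norm x * op_norm y"
    using z op_norm_nonneg x y by (intro mult_left_mono mult_left_le) auto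
  finally show "l2_norm P (mul (mul x y) z) \<le> op_norm x * op_norm y" .
qed

text \<open>
  For \<open>y\<close> in the unit ball, \<open>\<parallel>x y\<parallel>\<^sup>2 = \<langle>x y, x y\<rangle> = \<langle>y, x\<^sup>* x y\<rangle>\<close>, and the Cauchy-Schwarz inequality
  bounds the right-hand side by the norm of \<open>x\<^sup>* x\<close>.
\<close>

lemma op_norm_power2_le:
  assumes x: "x \<in> extensional P"
  shows "(op_norm x)\<^sup>2 \<le> op_norm (mul (star x) x)"
proof -
  have "op_norm x \<le> sqrt (op_norm (mul (star x) x))"
  proof (rule op_norm_le)
    fix y assume y: "y \<in> extensional P" "l2_norm P y \<le> 1"
    have "inner_on P (mul x y) (mul x y) = inner_on P y (mul (mul (star x) x) y)"
      by (simp add: adjoint x y closed mul_assoc)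
    then have "complex_of_real ((l2_norm P (mul x y))\<^sup>2) = inner_on P y (mul (mul (star x) x) y)"
      by (simp only: inner_on_self)
    then have "(l2_norm P (mul x y))\<^sup>2 = cmod (inner_on P y (mul (mul (star x) x) y))"
      by (metis norm_of_real abs_of_nonneg zero_le_power2)
    also have "\<dots> \<le> l2_norm P y * l2_norm P (mul (mul (star x) x) y)"
      by (rule cmod_inner_on_le)
    also have "\<dots> \<le> 1 * (op_norm (mul (star x) x) * 1)"
      using y by (intro mult_mono order_trans[OF l2_norm_mul_le] mult_left_mono)
        (auto simp: closed op_norm_nonneg)
    finally show "l2_norm P (mul x y) \<le> sqrt (op_norm (mul (star x) x))"
      by (simp add: real_le_rsqrt)
  qed
  then show ?thesis
    using op_norm_nonneg[OF x] by (simp add: real_le_rsqrt sqrt_ge_absD)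
qed

text \<open>
  Combined with submultiplicativity, the previous bound reads \<open>\<parallel>x\<parallel>\<^sup>2 \<le> \<parallel>x\<^sup>*\<parallel> \<parallel>x\<parallel>\<close>.  Applied to
  \<open>x\<^sup>*\<close> as well, it shows that the involution is isometric.
\<close>

lemma op_norm_star_le:
  assumes x: "x \<in> extensional P"
  shows "op_norm x \<le> op_norm (star x)"
proof -
  have "op_norm x * op_norm x \<le> op_norm (star x) * op_norm x"
    using op_norm_power2_le[OF x] op_norm_mul[OF star_closed[of x] x] by (simp add: power2_eq_square)
  then show ?thesis
    using op_norm_nonneg[OF x] op_norm_nonneg[OF star_closed[of x]]
    by (cases "op_norm x = 0") (auto simp: mult_le_cancel_right)
qed

lemma op_norm_Cstar_identity:
  assumes x: "x \<in> extensional P"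
  shows "op_norm (mul (star x) x) = (op_norm x)\<^sup>2"
proof -
  have "op_norm (star x) = op_norm x"
    using op_norm_star_le[OF x] op_norm_star_le[OF star_closed, of x] star_star[OF x] by simp
  then show ?thesis
    using op_norm_power2_le[OF x] op_norm_mul[OF star_closed[of x] x] by (simp add: power2_eq_square)
qed

lemma op_norm_topology:
  shows "Metric_space.mtopology (extensional P) (norm_dist (fun_space P) op_norm)
      = product_topology (\<lambda>_. euclidean) P"
    and "Metric_space.mcomplete (extensional P) (norm_dist (fun_space P) op_norm)"
proof -
  obtain K where K: "K \<ge> 0" "\<And>x. x \<in> extensional P \<Longrightarrow> op_norm x \<le> K * l2_norm P x"
    using op_norm_le_l2_norm by blast
  have minus: "op_norm (\<lambda>p\<in>P. - x p) = op_norm x" if "x \<in> extensional P" for x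
    using op_norm_scale[OF that, of "-1"] by simp
  have coord: "cmod (x p) \<le> l2_norm P e * op_norm x" if "x \<in> extensional P" "p \<in> P" for x p
    using cmod_le_l2_norm[OF finite that(2)] l2_norm_le_op_norm[OF that(1)] by (rule order_trans)
  have small: "op_norm x \<le> (K * real (card P)) * \<delta>"
    if "x \<in> extensional P" "\<And>p. p \<in> P \<Longrightarrow> cmod (x p) \<le> \<delta>" for x \<delta>
    using order_trans[OF K(2)[OF that(1)] mult_left_mono[OF l2_norm_le_card[OF that(2)] K(1)]]
    by (simp add: mult.assoc)
  note * = norm_equivalent_to_coordinates[OF finite, of op_norm, OF op_norm_nonneg op_norm_eq_0
      minus op_norm_triangle coord small]
  show "Metric_space.mtopology (extensional P) (norm_dist (fun_space P) op_norm)
      = product_topology (\<lambda>_. euclidean) P"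
    by (rule *(1))
  show "Metric_space.mcomplete (extensional P) (norm_dist (fun_space P) op_norm)"
    by (rule *(2))
qed

lemma unital_Cstar_algebra_op_norm:
  "unital_Cstar_algebra (fun_space P\<lparr>mult := mul, one := e\<rparr>) star op_norm"
    (is "unital_Cstar_algebra ?A _ _")
proof -
  interpret Module.module complex_ring ?A
    by (rule module_fun_space)
  have "ring ?A"
  proof (rule ringI)
    show "abelian_group ?A"
      by (rule abelian_group_fun_space)
    show "monoid ?A"
      by (rule monoidI) (simp_all add: closed mul_assoc unit_left unit_right)
  qed (simp_all add: mul_add_left mul_add_right)
  then interpret ring ?A .
  show ?thesis
    by unfold_locales
      (simp_all add: closed mul_scale_left mul_scale_right star_star star_add star_scale star_mul
        op_norm_nonneg op_norm_eq_0 op_norm_scale op_norm_triangle op_norm_mul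
        op_norm_Cstar_identity norm_dist_fun_space op_norm_topology)
qed

end

section \<open>The products of hypermatrices\<close>

lemma hypermatrix_space_eq: "hypermatrix_space n N = fun_space (hm_positions n N)"
  by (simp add: hypermatrix_space_def fun_space_def PiE_def)

lemma finite_multi_indices: "finite K \<Longrightarrow> finite (multi_indices K N)"
  unfolding multi_indices_def by (rule finite_PiE) auto

lemma finite_hm_positions: "finite (hm_positions n N)"
  by (simp add: hm_positions_def finite_multi_indices)

text \<open>
  The product is a matrix product at the levels in \<open>\<gamma>\<close>, whose unit is the identity matrix, and an
  entrywise product at the other levels, whose unit is the matrix with all entries \<open>1\<close>.
\<close>

definition hm_unit :: "nat \<Rightarrow> (nat \<Rightarrow> nat) \<Rightarrow> nat set \<Rightarrow> hypermatrix" where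
  "hm_unit n N \<gamma> = (\<lambda>(i, j)\<in>hm_positions n N. if \<forall>k\<in>\<gamma>. i k = j k then 1 else 0)"

context
  fixes n :: nat and N :: "nat \<Rightarrow> nat" and \<gamma> :: "nat set"
  assumes \<gamma>: "\<gamma> \<subseteq> {1..n}"
  (* Keeps {1..n} from becoming {Suc 0..n} in goals, where the membership facts would not match. *)
  notes One_nat_def [simp del]
begin

lemma finite_levels: "finite \<gamma>"
  using \<gamma> finite_subset by blast

lemma override_in_multi_indices:
  assumes "i \<in> multi_indices {1..n} N" and "l \<in> multi_indices \<gamma> N \<or> l \<in> multi_indices {1..n} N"
  shows "override_on i l \<gamma> \<in> multi_indices {1..n} N"
  using assms \<gamma> unfolding multi_indices_def PiE_iff extensional_def override_on_def by auto

lemma restrict_in_multi_indices: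
  "i \<in> multi_indices {1..n} N \<Longrightarrow> restrict i \<gamma> \<in> multi_indices \<gamma> N"
  using \<gamma> unfolding multi_indices_def PiE_iff by auto

lemma override_override: "override_on (override_on i l \<gamma>) m \<gamma> = override_on i m \<gamma>"
  by (auto simp: override_on_def)

lemma override_override_right: "override_on j (override_on i l \<gamma>) \<gamma> = override_on j l \<gamma>"
  by (auto simp: override_on_def)

lemma override_restrict: "override_on i (restrict j \<gamma>) \<gamma> = override_on i j \<gamma>"
  by (auto simp: override_on_def)

lemma override_self: "override_on i i \<gamma> = i"
  by (auto simp: override_on_def)

text \<open>
  In a sum over contraction indices \<open>l\<close> the unit selects exactly one term; this identifies it.
\<close>

lemma agree_iff_eq_restrict:
  assumes "l \<in> multi_indices \<gamma> N"
  shows "(\<forall>k\<in>\<gamma>. i k = l k) \<longleftrightarrow> l = restrict i \<gamma>"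
  using assms unfolding multi_indices_def PiE_iff extensional_def by (auto simp: fun_eq_iff)

lemma hm_mult_apply:
  assumes "i \<in> multi_indices {1..n} N" "j \<in> multi_indices {1..n} N"
  shows "hm_mult n N \<gamma> x y (i, j)
    = (\<Sum>l\<in>multi_indices \<gamma> N. x (i, override_on j l \<gamma>) * y (override_on i l \<gamma>, j))"
  using assms by (simp add: hm_mult_def hm_positions_def)

lemma hm_mult_assoc:
  "hm_mult n N \<gamma> (hm_mult n N \<gamma> x y) z = hm_mult n N \<gamma> x (hm_mult n N \<gamma> y z)"
proof (rule extensionalityI[of _ "hm_positions n N"])
  fix p assume "p \<in> hm_positions n N"
  then obtain i j where p: "p = (i, j)" "i \<in> multi_indices {1..n} N" "j \<in> multi_indices {1..n} N"
    by (auto simp: hm_positions_def)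
  have "hm_mult n N \<gamma> (hm_mult n N \<gamma> x y) z p
    = (\<Sum>l\<in>multi_indices \<gamma> N. \<Sum>m\<in>multi_indices \<gamma> N. x (i, override_on j m \<gamma>)
        * y (override_on i m \<gamma>, override_on j l \<gamma>) * z (override_on i l \<gamma>, j))"
    by (simp add: p hm_mult_apply override_in_multi_indices override_override sum_distrib_right)
  also have "\<dots> = (\<Sum>m\<in>multi_indices \<gamma> N. \<Sum>l\<in>multi_indices \<gamma> N. x (i, override_on j m \<gamma>)
        * y (override_on i m \<gamma>, override_on j l \<gamma>) * z (override_on i l \<gamma>, j))"
    by (rule sum.swap)
  also have "\<dots> = hm_mult n N \<gamma> x (hm_mult n N \<gamma> y z) p"
    by (simp add: p hm_mult_apply override_in_multi_indices override_override sum_distrib_left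
        mult.assoc)
  finally show "hm_mult n N \<gamma> (hm_mult n N \<gamma> x y) z p = hm_mult n N \<gamma> x (hm_mult n N \<gamma> y z) p" .
qed (simp_all add: hm_mult_def)

lemma hm_unit_override:
  assumes "i \<in> multi_indices {1..n} N" "j \<in> multi_indices {1..n} N" "l \<in> multi_indices \<gamma> N"
  shows "hm_unit n N \<gamma> (i, override_on j l \<gamma>) = (if l = restrict i \<gamma> then 1 else 0)"
    and "hm_unit n N \<gamma> (override_on i l \<gamma>, j) = (if l = restrict j \<gamma> then 1 else 0)"
  using assms agree_iff_eq_restrict[OF assms(3), of i] agree_iff_eq_restrict[OF assms(3), of j]
  by (auto simp: hm_unit_def hm_positions_def override_in_multi_indices)

lemma hm_unit_left:
  assumes "x \<in> extensional (hm_positions n N)"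
  shows "hm_mult n N \<gamma> (hm_unit n N \<gamma>) x = x"
proof (rule extensionalityI[of _ "hm_positions n N"])
  fix p assume "p \<in> hm_positions n N"
  then obtain i j where p: "p = (i, j)" "i \<in> multi_indices {1..n} N" "j \<in> multi_indices {1..n} N"
    by (auto simp: hm_positions_def)
  then show "hm_mult n N \<gamma> (hm_unit n N \<gamma>) x p = x p"
    by (simp add: hm_mult_apply hm_unit_override if_distrib[of "\<lambda>c. c * _"] override_restrict override_self
        restrict_in_multi_indices finite_multi_indices finite_levels cong: if_cong)
qed (use assms in \<open>simp_all add: hm_mult_def\<close>)

lemma hm_unit_right:
  assumes "x \<in> extensional (hm_positions n N)"
  shows "hm_mult n N \<gamma> x (hm_unit n N \<gamma>) = x"
proof (rule extensionalityI[of _ "hm_positions n N"])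
  fix p assume "p \<in> hm_positions n N"
  then obtain i j where p: "p = (i, j)" "i \<in> multi_indices {1..n} N" "j \<in> multi_indices {1..n} N"
    by (auto simp: hm_positions_def)
  then show "hm_mult n N \<gamma> x (hm_unit n N \<gamma>) p = x p"
    by (simp add: hm_mult_apply hm_unit_override if_distrib[of "\<lambda>c. _ * c"] override_restrict override_self
        restrict_in_multi_indices finite_multi_indices finite_levels cong: if_cong)
qed (use assms in \<open>simp_all add: hm_mult_def\<close>)

text \<open>
  Each entry of a product is a sum over the contraction indices of products of two
  entries, and no entry exceeds the \<open>\<ell>\<^sup>2\<close>-norm.  The resulting constant is far from optimal, but any
  constant suffices for comparing topologies.
\<close>

lemma hm_mult_bounded:
  "l2_norm (hm_positions n N) (hm_mult n N \<gamma> x y)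
    \<le> card (hm_positions n N) * card (multi_indices \<gamma> N)
      * l2_norm (hm_positions n N) x * l2_norm (hm_positions n N) y"
proof -
  let ?P = "hm_positions n N"
  have "cmod (hm_mult n N \<gamma> x y p) \<le> card (multi_indices \<gamma> N) * (l2_norm ?P x * l2_norm ?P y)"
    if "p \<in> ?P" for p
  proof -
    from that obtain i j
      where p: "p = (i, j)" "i \<in> multi_indices {1..n} N" "j \<in> multi_indices {1..n} N"
      by (auto simp: hm_positions_def)
    have "cmod (x (i, override_on j l \<gamma>) * y (override_on i l \<gamma>, j)) \<le> l2_norm ?P x * l2_norm ?P y"
      if "l \<in> multi_indices \<gamma> N" for l
      unfolding norm_mult
      by (intro mult_mono cmod_le_l2_norm)
        (use p that in \<open>auto simp: hm_positions_def finite_multi_indices override_in_multi_indices\<close>)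
    then show ?thesis
      unfolding p(1) hm_mult_apply[OF p(2,3)]
      by (intro sum_norm_bound) simp
  qed
  from l2_norm_le_card[of ?P, OF this] show ?thesis
    by (simp add: mult_ac)
qed

text \<open>
  Write \<open>i[l]\<close> for the index \<open>i\<close> with its levels in \<open>\<gamma>\<close> replaced by those of \<open>l\<close>.  The
  left-hand side sums \<open>cnj (x (i, j[l]) * y (i[l], j)) * z (i, j)\<close>.  The map that sends \<open>(i, l)\<close> to
  \<open>(i[l], i)\<close>, with the second \<open>i\<close> restricted to \<open>\<gamma>\<close>, exchanges the contracted and the free levels
  in \<open>\<gamma>\<close> and is its own inverse.  Substituting it moves \<open>i[l]\<close> from \<open>y\<close> to \<open>z\<close> and
  turns the entry of \<open>x\<close> into \<open>x (i[l], j[i])\<close>, whose conjugate is the entry of the involution of \<open>x\<close>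
  at \<open>(i, j[l])\<close>.
\<close>

lemma hm_mult_adjoint:
  "inner_on (hm_positions n N) (hm_mult n N \<gamma> x y) z
    = inner_on (hm_positions n N) y (hm_mult n N \<gamma> (hm_star n N \<gamma> x) z)"
proof -
  let ?I = "multi_indices {1..n} N" and ?L = "multi_indices \<gamma> N"
  let ?o = "\<lambda>i l. override_on i l \<gamma>"
  have res: "restrict (?o i l) \<gamma> = l" if "l \<in> ?L" for i l :: multi_index
    using that unfolding multi_indices_def PiE_iff extensional_def override_on_def
    by (auto simp: fun_eq_iff)
  have "inner_on (hm_positions n N) (hm_mult n N \<gamma> x y) z
    = (\<Sum>i\<in>?I. \<Sum>j\<in>?I. \<Sum>l\<in>?L. cnj (x (i, ?o j l)) * cnj (y (?o i l, j)) * z (i, j))"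
    unfolding inner_on_def hm_positions_def
    by (simp add: hm_mult_apply sum_distrib_right sum.cartesian_product')
  also have "\<dots> = (\<Sum>j\<in>?I. \<Sum>(i, l)\<in>?I \<times> ?L. cnj (x (i, ?o j l)) * cnj (y (?o i l, j)) * z (i, j))"
    by (subst sum.swap) (simp add: sum.cartesian_product)
  also have "\<dots> = (\<Sum>j\<in>?I. \<Sum>(i, l)\<in>?I \<times> ?L. cnj (y (i, j)) * cnj (x (?o i l, ?o j i)) * z (?o i l, j))"
  proof (rule sum.cong[OF refl])
    fix j assume "j \<in> ?I"
    show "(\<Sum>(i, l)\<in>?I \<times> ?L. cnj (x (i, ?o j l)) * cnj (y (?o i l, j)) * z (i, j))
      = (\<Sum>(i, l)\<in>?I \<times> ?L. cnj (y (i, j)) * cnj (x (?o i l, ?o j i)) * z (?o i l, j))"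
      by (rule sum.reindex_bij_witness[of _ "\<lambda>(i, l). (?o i l, restrict i \<gamma>)"
            "\<lambda>(i, l). (?o i l, restrict i \<gamma>)"])
        (auto simp: res override_in_multi_indices restrict_in_multi_indices override_restrict
            override_override override_override_right override_self)
  qed
  also have "\<dots> = (\<Sum>i\<in>?I. \<Sum>j\<in>?I. \<Sum>l\<in>?L. cnj (y (i, j)) * cnj (x (?o i l, ?o j i)) * z (?o i l, j))"
    by (subst (2) sum.swap) (simp add: sum.cartesian_product)
  also have "\<dots> = inner_on (hm_positions n N) y (hm_mult n N \<gamma> (hm_star n N \<gamma> x) z)"
  proof -
    have "hm_star n N \<gamma> x (i, ?o j l) = cnj (x (?o i l, ?o j i))"
      if "i \<in> ?I" "j \<in> ?I" "l \<in> ?L" for i j l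
      using that by (simp add: hm_star_def hm_positions_def override_in_multi_indices
          override_override override_override_right)
    then show ?thesis
      unfolding inner_on_def hm_positions_def
      by (simp add: hm_mult_apply sum_distrib_left sum.cartesian_product' mult.assoc)
  qed
  finally show ?thesis .
qed

lemma adjointable_fun_algebra_hm:
  "adjointable_fun_algebra (hm_positions n N) (hm_mult n N \<gamma>) (hm_star n N \<gamma>) (hm_unit n N \<gamma>)"
proof
  show "finite (hm_positions n N)"
    by (rule finite_hm_positions)
  show "\<exists>K\<ge>0. \<forall>x\<in>extensional (hm_positions n N). \<forall>y\<in>extensional (hm_positions n N).
      l2_norm (hm_positions n N) (hm_mult n N \<gamma> x y)
        \<le> K * l2_norm (hm_positions n N) x * l2_norm (hm_positions n N) y"
    using hm_mult_bounded
    by (intro exI[of _ "real (card (hm_positions n N)) * real (card (multi_indices \<gamma> N))"]) auto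
  fix x y z :: hypermatrix and c
  show "hm_mult n N \<gamma> (\<lambda>p\<in>hm_positions n N. x p + y p) z
      = (\<lambda>p\<in>hm_positions n N. hm_mult n N \<gamma> x z p + hm_mult n N \<gamma> y z p)"
    and "hm_mult n N \<gamma> z (\<lambda>p\<in>hm_positions n N. x p + y p)
      = (\<lambda>p\<in>hm_positions n N. hm_mult n N \<gamma> z x p + hm_mult n N \<gamma> z y p)"
    and "hm_mult n N \<gamma> (\<lambda>p\<in>hm_positions n N. c * x p) y
      = (\<lambda>p\<in>hm_positions n N. c * hm_mult n N \<gamma> x y p)"
    and "hm_mult n N \<gamma> x (\<lambda>p\<in>hm_positions n N. c * y p)
      = (\<lambda>p\<in>hm_positions n N. c * hm_mult n N \<gamma> x y p)"
    by (auto intro!: extensionalityI[of _ "hm_positions n N"] sum.cong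
        simp: hm_mult_def hm_positions_def override_in_multi_indices algebra_simps
          sum_distrib_left simp flip: sum.distrib)
qed (simp_all add: hm_mult_assoc hm_unit_left hm_unit_right hm_mult_adjoint,
    simp_all add: hm_mult_def hm_star_def hm_unit_def)

end

theorem theorem5p33:
  fixes n :: nat and N :: "nat \<Rightarrow> nat"
  assumes "\<And>k. k \<in> {1..n} \<Longrightarrow> 0 < N k"
  shows "hyper_Cstar_algebra (hypermatrix_space n N) (hypermatrix_topology n N)
           (Pow {1..n}) (hm_mult n N) (hm_star n N)"
  unfolding hyper_Cstar_algebra_def hypermatrix_space_eq hypermatrix_topology_def
proof (intro conjI ballI)
  show "complete_complex_topological_vector_space (fun_space (hm_positions n N))
      (product_topology (\<lambda>_. euclidean) (hm_positions n N))"
    by (rule complete_tvs_fun_space[OF finite_hm_positions])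
  show "finite (Pow {1..n})"
    by simp
  fix \<gamma> assume "\<gamma> \<in> Pow {1..n}"
  then interpret adjointable_fun_algebra "hm_positions n N" "hm_mult n N \<gamma>" "hm_star n N \<gamma>"
    "hm_unit n N \<gamma>"
    by (intro adjointable_fun_algebra_hm) simp
  show "\<exists>e nrm. unital_Cstar_algebra
        (fun_space (hm_positions n N)\<lparr>mult := hm_mult n N \<gamma>, one := e\<rparr>) (hm_star n N \<gamma>) nrm \<and>
      Metric_space.mtopology (carrier (fun_space (hm_positions n N)))
        (norm_dist (fun_space (hm_positions n N)) nrm)
      = product_topology (\<lambda>_. euclidean) (hm_positions n N)"
    using unital_Cstar_algebra_op_norm op_norm_topology(1) by auto
qed

end
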